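(* Let $\theta>0$. Let $w=(w_k)_{k\ge1}$ be a real sequence, put $a_1=w_1$, and put $a_j=w_j-w_{j-1}$ for $j\ge2$. Suppose that $a_1\ne0$, that $a=(a_j)_{j\ge1}\in\ell^1_\theta$, and that the Dirichlet inverse $b=a^{(-1)}$, characterized by $a\ast b=e$ with $e_1=1$ and $e_j=0$ for $j\ge2$, also belongs to $\ell^1_\theta$. Define \[ \mathcal T_w(G_x)=\sum_{k\ge1}w_k s_k(G_x),\qquad \mathcal M_w(x)=\sum_{k\ge1}w_k\left(\operatorname{Li}(x/k)-\operatorname{Li}(x/(k+1))\right). \] Then for every $m\ge0$, \[ \pi(x)-\operatorname{Li}(x)=O\!\left(x^\theta\log^m(ex)\right) \] if and only if \[ \mathcal T_w(G_x)-\mathcal M_w(x)=O\!\left(x^\theta\log^m(ex)\right). \] The hypotheses on $b$ hold, in particular, whenever \[ \kappa_\theta=\frac{1}{|a_1|}\sum_{j=2}^\infty\frac{|a_j|}{j^\theta}<1 . \]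
   Context: For an integer $n\ge2$, $G_n$ is the simple graph with vertex set $\{2,\ldots,n\}$ in which two distinct vertices $x,y$ are adjacent if and only if $\gcd(x,y)>1$; for real $x\ge2$, $G_x=G_{\lfloor x\rfloor}$. A vertex is simplicial if its open neighborhood induces a clique (possibly empty). Two vertices are true twins if their closed neighborhoods are equal; simpliciality and degree are constant on each true-twin class. For $k\ge1$, $s_k(G_x)$ is the number of true-twin classes of simplicial vertices of $G_x$ whose common degree is $k-1$. For a sequence $c=(c_j)_{j\ge1}$, $\|c\|_{\ell^1_\theta}=\sum_{j\ge1}|c_j|j^{-\theta}$, and $\ell^1_\theta$ is the space of sequences with finite norm. Dirichlet convolution is $(c\ast d)_n=\sum_{r\mid n}c_r d_{n/r}$. $\pi(x)$ is the number of primes at most $x$; $\operatorname{Li}(x)=\int_2^x\frac{dt}{\log t}$ for $x\ge2$, and $\operatorname{Li}(x)=\pi(x)=0$ for $x<2$. For each $x$ the sums defining $\mathcal T_w(G_x)$ and $\mathcal M_w(x)$ have only finitely many nonzero terms. The $O$-estimates are for all real $x\ge2$. *)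

theory Defs
  imports
    "HOL-Analysis.Analysis"
    "HOL-Library.Landau_Symbols"
    "HOL-Computational_Algebra.Primes"
begin

record 'a sgraph =
  verts :: "'a set"
  adj :: "'a \<Rightarrow> 'a \<Rightarrow> bool"

definition nbhd :: "'a sgraph \<Rightarrow> 'a \<Rightarrow> 'a set" where
  "nbhd G v = {u \<in> verts G. adj G v u}"

definition closed_nbhd :: "'a sgraph \<Rightarrow> 'a \<Rightarrow> 'a set" where
  "closed_nbhd G v = insert v (nbhd G v)"

definition vdegree :: "'a sgraph \<Rightarrow> 'a \<Rightarrow> nat" where
  "vdegree G v = card (nbhd G v)"

definition is_clique :: "'a sgraph \<Rightarrow> 'a set \<Rightarrow> bool" where
  "is_clique G K \<longleftrightarrow> K \<subseteq> verts G \<and> (\<forall>u\<in>K. \<forall>v\<in>K. u \<noteq> v \<longrightarrow> adj G u v)"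

definition simplicial :: "'a sgraph \<Rightarrow> 'a \<Rightarrow> bool" where
  "simplicial G v \<longleftrightarrow> v \<in> verts G \<and> is_clique G (nbhd G v)"

definition true_twins :: "'a sgraph \<Rightarrow> ('a \<times> 'a) set" where
  "true_twins G = {(u, v). u \<in> verts G \<and> v \<in> verts G \<and> closed_nbhd G u = closed_nbhd G v}"

text \<open>Simpliciality and degree are constant on a true-twin class, so it is immaterial whether
  the condition below is imposed on all members of the class or on one of them.\<close>

definition simplicial_class_count :: "nat \<Rightarrow> 'a sgraph \<Rightarrow> nat" where
  "simplicial_class_count k G =
     card {C \<in> verts G // true_twins G. \<forall>v\<in>C. simplicial G v \<and> vdegree G v = k - 1}"

definition gcd_graph :: "real \<Rightarrow> nat sgraph" where
  "gcd_graph x = \<lparr>verts = {2..nat \<lfloor>x\<rfloor>}, adj = (\<lambda>u v. u \<noteq> v \<and> gcd u v > 1)\<rparr>"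

definition prime_pi :: "real \<Rightarrow> real" where
  "prime_pi x = real (card {p::nat. prime p \<and> real p \<le> x})"

definition Li :: "real \<Rightarrow> real" where
  "Li x = (if x < 2 then 0 else integral {2..x} (\<lambda>t. 1 / ln t))"

text \<open>Sequences are indexed by the positive integers; the value at index \<open>0\<close> is never used.\<close>

definition ell1 :: "real \<Rightarrow> (nat \<Rightarrow> real) set" where
  "ell1 \<theta> = {c. (\<lambda>j. \<bar>c j\<bar> * real j powr (-\<theta>)) summable_on {1..}}"

definition dirichlet_conv :: "(nat \<Rightarrow> real) \<Rightarrow> (nat \<Rightarrow> real) \<Rightarrow> nat \<Rightarrow> real" where
  "dirichlet_conv c d n = (\<Sum>r | r dvd n. c r * d (n div r))"

definition is_dirichlet_inverse :: "(nat \<Rightarrow> real) \<Rightarrow> (nat \<Rightarrow> real) \<Rightarrow> bool" where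
  "is_dirichlet_inverse a b \<longleftrightarrow>
     (\<forall>n\<ge>1. dirichlet_conv a b n = (if n = 1 then 1 else 0))"

text \<open>For every \<open>x\<close> the next two sums have only finitely many nonzero terms.\<close>

definition T_sum :: "(nat \<Rightarrow> real) \<Rightarrow> real \<Rightarrow> real" where
  "T_sum w x = (\<Sum>\<^sub>\<infinity>k\<in>{1..}. w k * real (simplicial_class_count k (gcd_graph x)))"

definition M_sum :: "(nat \<Rightarrow> real) \<Rightarrow> real \<Rightarrow> real" where
  "M_sum w x = (\<Sum>\<^sub>\<infinity>k\<in>{1..}. w k * (Li (x / real k) - Li (x / real (k + 1))))"

text \<open>Over the filter \<open>principal {2..}\<close>, Landau's \<open>O\<close> asks for one constant valid at every
  real \<open>x \<ge> 2\<close>, and not merely for all sufficiently large \<open>x\<close>.\<close>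

end

theory Submission
  imports Defs
begin

text \<open>A simplicial vertex of the gcd graph has a single prime divisor \<open>p\<close>, for otherwise two
  distinct prime divisors would be non-adjacent neighbours of it; its closed neighbourhood is then
  the set of multiples of \<open>p\<close>.  Hence the simplicial classes correspond to the primes \<open>p \<le> x\<close>, and
  the one of \<open>p\<close> has degree \<open>\<lfloor>x/p\<rfloor> - 1\<close>.  Abel summation turns \<open>T_sum w x - M_sum w x\<close> into
  \<open>\<Sum>k. a k * E (x/k)\<close> with \<open>E = prime_pi - Li\<close>.  This operation on \<open>E\<close> is inverted by the same
  operation with the Dirichlet inverse of \<open>a\<close> in place of \<open>a\<close>, and it preserves the bound
  \<open>O(x powr \<theta> * ln (e x) powr m)\<close> when its coefficients lie in \<open>ell1 \<theta>\<close>.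
  If \<open>\<kappa> < 1\<close> is the constant of the second part, the recursion for the Dirichlet inverse \<open>b\<close> gives
  \<open>\<bar>a 1\<bar> * B N \<le> 1 + \<kappa> * \<bar>a 1\<bar> * B N\<close> for \<open>B N = (\<Sum>n\<le>N. \<bar>b n\<bar> / n powr \<theta>)\<close>, which bounds \<open>B N\<close>.\<close>

section \<open>Simplicial classes of the gcd graph\<close>

lemma gcd_gt_1_iff_common_prime:
  fixes u v :: nat
  assumes "v > 0"
  shows "gcd v u > 1 \<longleftrightarrow> (\<exists>p. prime p \<and> p dvd v \<and> p dvd u)"
proof
  assume "gcd v u > 1"
  then obtain p where "prime p" "p dvd gcd v u"
    using prime_factor_nat[of "gcd v u"] by auto
  then show "\<exists>p. prime p \<and> p dvd v \<and> p dvd u" by auto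
next
  assume "\<exists>p. prime p \<and> p dvd v \<and> p dvd u"
  then obtain p where p: "prime p" "p dvd gcd v u" by auto
  have "gcd v u > 0" using assms by simp
  then have "p \<le> gcd v u" using p(2) by (rule dvd_imp_le[rotated])
  then show "gcd v u > 1" using prime_gt_1_nat[OF p(1)] by linarith
qed

lemma verts_gcd_graph [simp]: "verts (gcd_graph x) = {2..nat \<lfloor>x\<rfloor>}"
  by (simp add: gcd_graph_def)

lemma adj_gcd_graph [simp]: "adj (gcd_graph x) u v \<longleftrightarrow> u \<noteq> v \<and> gcd u v > 1"
  by (simp add: gcd_graph_def)

text \<open>A vertex \<open>v\<close> is at least 2, so \<open>gcd v v = v > 1\<close>: closing the
  neighbourhood just removes the condition \<open>u \<noteq> v\<close> from adjacency.\<close>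

lemma closed_nbhd_gcd_graph:
  assumes "v \<in> verts (gcd_graph x)"
  shows "closed_nbhd (gcd_graph x) v =
    {u \<in> verts (gcd_graph x). \<exists>p. prime p \<and> p dvd v \<and> p dvd u}"
proof -
  have "closed_nbhd (gcd_graph x) v = {u \<in> verts (gcd_graph x). gcd v u > 1}"
    using assms by (auto simp: closed_nbhd_def nbhd_def)
  then show ?thesis
    using assms gcd_gt_1_iff_common_prime[of v] by auto
qed

lemma closed_nbhd_gcd_graph_single_prime:
  assumes "v \<in> verts (gcd_graph x)" "prime p" "p dvd v" "\<And>q. prime q \<Longrightarrow> q dvd v \<Longrightarrow> q = p"
  shows "closed_nbhd (gcd_graph x) v = {u \<in> verts (gcd_graph x). p dvd u}"
  unfolding closed_nbhd_gcd_graph[OF assms(1)] using assms(2-4) by blast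

lemma prime_dvd_in_verts_gcd_graph:
  assumes "v \<in> verts (gcd_graph x)" "prime p" "p dvd v"
  shows "p \<in> verts (gcd_graph x)"
  using assms dvd_imp_le[of p v] prime_ge_2_nat[of p] by auto

lemma simplicial_gcd_graph_iff:
  assumes v: "v \<in> verts (gcd_graph x)" and p: "prime p" "p dvd v"
  shows "simplicial (gcd_graph x) v \<longleftrightarrow> (\<forall>q. prime q \<longrightarrow> q dvd v \<longrightarrow> q = p)"
proof
  assume s: "simplicial (gcd_graph x) v"
  show "\<forall>q. prime q \<longrightarrow> q dvd v \<longrightarrow> q = p"
  proof (intro allI impI, rule ccontr)
    fix q assume q: "prime q" "q dvd v" "q \<noteq> p"
    have cop: "coprime q p" using p q primes_coprime by blast
    \<comment> \<open>A prime has no second prime divisor, so \<open>v\<close> is neither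
      \<open>p\<close> nor \<open>q\<close>; hence both lie in the open neighbourhood.\<close>
    have "v \<noteq> p" using p q primes_dvd_imp_eq by blast
    moreover have "v \<noteq> q" using p q primes_dvd_imp_eq by blast
    moreover have "gcd v p > 1" "gcd v q > 1"
      using v p q gcd_gt_1_iff_common_prime[of v p] gcd_gt_1_iff_common_prime[of v q] by auto
    ultimately have "p \<in> nbhd (gcd_graph x) v" "q \<in> nbhd (gcd_graph x) v"
      using prime_dvd_in_verts_gcd_graph[OF v] p q by (auto simp: nbhd_def)
    then have "adj (gcd_graph x) q p"
      using s q(3) unfolding simplicial_def is_clique_def by blast
    then show False using cop by simp
  qed
next
  assume single: "\<forall>q. prime q \<longrightarrow> q dvd v \<longrightarrow> q = p"
  \<comment> \<open>All neighbours are multiples of \<open>p\<close>, so any two of them share the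
    factor \<open>p\<close>.\<close>
  have sub: "nbhd (gcd_graph x) v \<subseteq> {u \<in> verts (gcd_graph x). p dvd u}"
    using closed_nbhd_gcd_graph_single_prime[OF v p] single
    by (auto simp: closed_nbhd_def)
  have "gcd u u' > 1" if "u > 0" "p dvd u" "p dvd u'" for u u'
    using that p(1) gcd_gt_1_iff_common_prime[of u u'] by blast
  then show "simplicial (gcd_graph x) v"
    using v sub unfolding simplicial_def is_clique_def
    by (auto simp: subset_iff nbhd_def)
qed

lemma vdegree_gcd_graph:
  "vdegree (gcd_graph x) v = card (closed_nbhd (gcd_graph x) v) - 1"
proof -
  have "finite (nbhd (gcd_graph x) v)" "v \<notin> nbhd (gcd_graph x) v"
    by (auto simp: nbhd_def)
  then show ?thesis by (simp add: vdegree_def closed_nbhd_def)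
qed

text \<open>Since \<open>p \<ge> 2\<close>, starting the range at 2 loses no positive multiple of
  \<open>p\<close>; the multiples are \<open>p * i\<close> with
  \<open>1 \<le> i \<le> n div p\<close>.\<close>

lemma card_multiples:
  fixes p n :: nat
  assumes "p \<ge> 2"
  shows "card {u \<in> {2..n}. p dvd u} = n div p"
proof -
  have "bij_betw (\<lambda>i. p * i) {1..n div p} {u \<in> {2..n}. p dvd u}"
  proof (rule bij_betw_byWitness[where f' = "\<lambda>u. u div p"])
    show "(\<lambda>i. p * i) ` {1..n div p} \<subseteq> {u \<in> {2..n}. p dvd u}"
    proof clarsimp
      fix i assume i: "Suc 0 \<le> i" "i \<le> n div p"
      have "p * i \<le> p * (n div p)" using i by simp
      then have "p * i \<le> n" using times_div_less_eq_dividend[of p n] by linarith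
      moreover have "2 * 1 \<le> p * i" using i assms by (intro mult_le_mono) auto
      ultimately show "2 \<le> p * i \<and> p * i \<le> n" by simp
    qed
    show "(\<lambda>u. u div p) ` {u \<in> {2..n}. p dvd u} \<subseteq> {1..n div p}"
    proof clarsimp
      fix u assume u: "2 \<le> u" "u \<le> n" "p dvd u"
      have "p \<le> u" using u by (intro dvd_imp_le) auto
      then have "0 < u div p" using assms by (simp add: div_greater_zero_iff)
      then show "Suc 0 \<le> u div p \<and> u div p \<le> n div p" using u by (simp add: div_le_mono)
    qed
  qed (use assms in auto)
  from bij_betw_same_card[OF this] show ?thesis by simp
qed

text \<open>Each class counted contains exactly one prime, so sending a prime to its class is a
  bijection, and the degree can be read off at the prime.\<close>

lemma simplicial_class_count_gcd_graph:
  assumes "k \<ge> 1"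
  shows "simplicial_class_count k (gcd_graph x) =
    card {p. prime p \<and> p \<le> nat \<lfloor>x\<rfloor> \<and> nat \<lfloor>x\<rfloor> div p = k}"
proof -
  define V where "V = verts (gcd_graph x)"
  define R where "R = true_twins (gcd_graph x)"
  define P where "P = {p. prime p \<and> p \<le> nat \<lfloor>x\<rfloor> \<and> nat \<lfloor>x\<rfloor> div p = k}"
  have primeV: "p \<in> V" if "prime p" "p \<le> nat \<lfloor>x\<rfloor>" for p
    using that prime_ge_2_nat[of p] by (simp add: V_def)
  have cn: "closed_nbhd (gcd_graph x) p = {u \<in> V. p dvd u}" if "prime p" "p \<le> nat \<lfloor>x\<rfloor>" for p
    using that primeV unfolding V_def
    by (intro closed_nbhd_gcd_graph_single_prime) (auto dest: primes_dvd_imp_eq)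
  have deg: "vdegree (gcd_graph x) p = nat \<lfloor>x\<rfloor> div p - 1" if "prime p" "p \<le> nat \<lfloor>x\<rfloor>" for p
    using that cn card_multiples[of p] prime_ge_2_nat[of p] by (simp add: vdegree_gcd_graph V_def)
  have R_iff: "(u, v) \<in> R \<longleftrightarrow> u \<in> V \<and> v \<in> V \<and>
    closed_nbhd (gcd_graph x) u = closed_nbhd (gcd_graph x) v" for u v
    by (auto simp: R_def true_twins_def V_def)
  have cl: "{C \<in> V // R. \<forall>v\<in>C. simplicial (gcd_graph x) v \<and> vdegree (gcd_graph x) v = k - 1} =
    (\<lambda>p. R `` {p}) ` P" (is "?L = ?R")
  proof (intro equalityI subsetI)
    fix C assume C: "C \<in> ?L"
    then obtain v where v: "v \<in> V" "C = R `` {v}" by (auto simp: quotient_def)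
    then have vC: "v \<in> C" by (auto simp: R_iff)
    have "v \<noteq> 1" using v by (auto simp: V_def)
    then obtain p where p: "prime p" "p dvd v" using prime_factor_nat by blast
    have pV: "p \<in> V" using prime_dvd_in_verts_gcd_graph v p unfolding V_def by blast
    then have pn: "p \<le> nat \<lfloor>x\<rfloor>" by (simp add: V_def)
    have "closed_nbhd (gcd_graph x) v = {u \<in> V. p dvd u}"
      using simplicial_gcd_graph_iff[of v x p] v p C vC
        closed_nbhd_gcd_graph_single_prime[of v x p] unfolding V_def by blast
    then have same: "closed_nbhd (gcd_graph x) v = closed_nbhd (gcd_graph x) p"
      using cn[OF p(1) pn] by simp
    have CR: "C = R `` {p}" using same v pV by (auto simp: R_iff)
    have "vdegree (gcd_graph x) v = k - 1" using C vC by blast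
    then have "vdegree (gcd_graph x) p = k - 1" using same by (simp add: vdegree_gcd_graph)
    then have "nat \<lfloor>x\<rfloor> div p - 1 = k - 1" using deg[OF p(1) pn] by simp
    \<comment> \<open>Subtraction on \<open>nat\<close> truncates at 0; the \<open>- 1\<close>
      cancels because the quotient and \<open>k\<close> are both positive.\<close>
    moreover have "nat \<lfloor>x\<rfloor> div p > 0" using pn p(1) by (simp add: div_greater_zero_iff prime_gt_0_nat)
    ultimately have "nat \<lfloor>x\<rfloor> div p = k" using assms by linarith
    then show "C \<in> ?R" using CR p pn by (auto simp: P_def)
  next
    fix C assume "C \<in> ?R"
    then obtain p where p: "prime p" "p \<le> nat \<lfloor>x\<rfloor>" "nat \<lfloor>x\<rfloor> div p = k" "C = R `` {p}"
      by (auto simp: P_def)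
    have "C \<in> V // R" using primeV[OF p(1,2)] p(4) by (auto intro: quotientI)
    moreover have "simplicial (gcd_graph x) v \<and> vdegree (gcd_graph x) v = k - 1" if "v \<in> C" for v
    proof
      have v: "v \<in> V" and e: "closed_nbhd (gcd_graph x) v = closed_nbhd (gcd_graph x) p"
        using that p(4) by (auto simp: R_iff)
      have e': "closed_nbhd (gcd_graph x) v = {u \<in> V. p dvd u}" using e cn[OF p(1,2)] by simp
      have "v \<in> closed_nbhd (gcd_graph x) v" by (simp add: closed_nbhd_def)
      then have pv: "p dvd v" using e' by blast
      \<comment> \<open>A prime divisor \<open>q\<close> of \<open>v\<close> is itself a vertex in
        the closed neighbourhood of \<open>v\<close>, which consists of multiples of
        \<open>p\<close>.\<close>
      have "q = p" if q: "prime q" "q dvd v" for q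
      proof -
        have "q \<in> V" using prime_dvd_in_verts_gcd_graph v q unfolding V_def by blast
        then have "q \<in> closed_nbhd (gcd_graph x) v"
          using v q by (auto simp: closed_nbhd_gcd_graph V_def)
        then have "p dvd q" using e' by blast
        then show "q = p" using p(1) q(1) primes_dvd_imp_eq by blast
      qed
      then show "simplicial (gcd_graph x) v"
        using simplicial_gcd_graph_iff[of v x p] v p(1) pv unfolding V_def by blast
      show "vdegree (gcd_graph x) v = k - 1"
        using e deg[OF p(1,2)] p(3) by (simp add: vdegree_gcd_graph)
    qed
    ultimately show "C \<in> ?L" by blast
  qed
  have "inj_on (\<lambda>p. R `` {p}) P"
  proof (rule inj_onI)
    fix p q assume pq: "p \<in> P" "q \<in> P" "R `` {p} = R `` {q}"
    have V: "p \<in> V" "q \<in> V" using pq primeV by (auto simp: P_def)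
    have "q \<in> R `` {p}" unfolding pq(3) using V by (simp add: R_iff)
    then have "(p, q) \<in> R" by simp
    then have "{u \<in> V. p dvd u} = {u \<in> V. q dvd u}" using cn pq by (auto simp: R_iff P_def)
    then have "q \<in> {u \<in> V. p dvd u}" using V by simp
    then have "p dvd q" by simp
    then show "p = q" using pq primes_dvd_imp_eq by (auto simp: P_def)
  qed
  then have "card ((\<lambda>p. R `` {p}) ` P) = card P" by (rule card_image)
  then show ?thesis using cl by (simp add: simplicial_class_count_def V_def R_def P_def)
qed

section \<open>Class counts in terms of the prime counting function\<close>

lemma real_le_divide_iff_nat_floor:
  assumes "k \<ge> 1" "x \<ge> 0"
  shows "real p \<le> x / real k \<longleftrightarrow> p * k \<le> nat \<lfloor>x\<rfloor>"
proof -
  have "real p \<le> x / real k \<longleftrightarrow> real (p * k) \<le> x"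
    using assms by (simp add: field_simps)
  also have "\<dots> \<longleftrightarrow> p * k \<le> nat \<lfloor>x\<rfloor>"
    using assms(2) le_nat_floor[of "p * k" x] of_nat_floor[of x] of_nat_le_iff[of "p * k" "nat \<lfloor>x\<rfloor>", where 'a = real]
    by (meson order_trans)
  finally show ?thesis .
qed

lemma finite_primes_le_real: "finite {p::nat. prime p \<and> real p \<le> y}"
proof (rule finite_subset)
  show "{p::nat. prime p \<and> real p \<le> y} \<subseteq> {..nat \<lfloor>y\<rfloor>}" by (auto intro: le_nat_floor)
qed simp

text \<open>The quotient condition means
  \<open>p * k \<le> \<lfloor>x\<rfloor> < p * (k + 1)\<close>, that is,
  \<open>x/(k + 1) < p \<le> x/k\<close>.\<close>

lemma simplicial_class_count_eq_prime_pi: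
  assumes "k \<ge> 1" "x \<ge> 0"
  shows "real (simplicial_class_count k (gcd_graph x)) =
    prime_pi (x / real k) - prime_pi (x / real (k + 1))"
proof -
  let ?A = "\<lambda>y. {p::nat. prime p \<and> real p \<le> y}"
  have "x / real (k + 1) \<le> x / real k" using assms by (intro divide_left_mono) auto
  then have sub: "?A (x / real (k + 1)) \<subseteq> ?A (x / real k)" by (auto intro: order_trans)
  have "p \<le> nat \<lfloor>x\<rfloor> \<and> nat \<lfloor>x\<rfloor> div p = k \<longleftrightarrow>
      real p \<le> x / real k \<and> \<not> real p \<le> x / real (k + 1)" if "prime p" for p
  proof -
    have p: "p > 0" using that by (rule prime_gt_0_nat)
    have "nat \<lfloor>x\<rfloor> div p = k \<longleftrightarrow> p * k \<le> nat \<lfloor>x\<rfloor> \<and> nat \<lfloor>x\<rfloor> < p * (k + 1)"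
      using p by (metis Suc_eq_plus1 div_nat_eqI dividend_less_times_div mult.commute times_div_less_eq_dividend mult_Suc_right add.commute)
    moreover have "p \<le> p * k" using assms(1) by simp
    moreover have "real p \<le> x / real k \<longleftrightarrow> p * k \<le> nat \<lfloor>x\<rfloor>"
        "real p \<le> x / real (k + 1) \<longleftrightarrow> p * (k + 1) \<le> nat \<lfloor>x\<rfloor>"
      using assms by (intro real_le_divide_iff_nat_floor; simp)+
    ultimately show ?thesis by linarith
  qed
  then have "{p. prime p \<and> p \<le> nat \<lfloor>x\<rfloor> \<and> nat \<lfloor>x\<rfloor> div p = k} =
      ?A (x / real k) - ?A (x / real (k + 1))" by auto
  then have "simplicial_class_count k (gcd_graph x) =
      card (?A (x / real k)) - card (?A (x / real (k + 1)))"
    using simplicial_class_count_gcd_graph[OF assms(1)] card_Diff_subset[OF finite_primes_le_real sub] by simp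
  then show ?thesis
    using card_mono[OF finite_primes_le_real sub] by (simp add: prime_pi_def of_nat_diff)
qed

lemma prime_pi_eq_0:
  assumes "y < 2"
  shows "prime_pi y = 0"
proof -
  have "\<not> real p \<le> y" if "prime p" for p :: nat
    using prime_ge_2_nat[OF that] assms by linarith
  then have "{p::nat. prime p \<and> real p \<le> y} = {}" by blast
  then show ?thesis by (simp only: prime_pi_def card.empty of_nat_0)
qed

section \<open>Dirichlet convolution\<close>

text \<open>Finite form of the sum over all \<open>k \<ge> 1\<close>. For \<open>x \<ge> 0\<close>
  the cutoff changes nothing when \<open>F\<close> vanishes below 2, since \<open>x/k < 1\<close>
  beyond it.\<close>

definition dilation_sum :: "(nat \<Rightarrow> real) \<Rightarrow> (real \<Rightarrow> real) \<Rightarrow> real \<Rightarrow> real" where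
  "dilation_sum c F x = (\<Sum>k = 1..nat \<lfloor>x\<rfloor>. c k * F (x / real k))"

section \<open>Abel summation of weighted differences\<close>

lemma divide_lt_1_of_nat_floor_less:
  assumes "nat \<lfloor>x\<rfloor> < k" "x \<ge> 0"
  shows "x / real k < 1"
proof -
  have "x < real k" using assms by linarith
  then show ?thesis using assms by (simp add: divide_simps)
qed

text \<open>Induction on \<open>N\<close> keeps track of the boundary term. It is suppressed at
  \<open>N = 0\<close>, where \<open>w 0\<close> is an arbitrary value.\<close>

lemma sum_by_parts:
  fixes w a F :: "nat \<Rightarrow> real"
  assumes "a 1 = w 1" "\<And>j. j \<ge> 2 \<Longrightarrow> a j = w j - w (j - 1)"
  shows "(\<Sum>k = 1..N. w k * (F k - F (k + 1))) = (\<Sum>k = 1..N. a k * F k) - (if N = 0 then 0 else w N * F (N + 1))"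
proof (induction N)
  case (Suc N)
  show ?case
  proof (cases "N = 0")
    case False
    then have w: "w (Suc N) = w N + a (Suc N)" using assms(2)[of "Suc N"] by simp
    show ?thesis using Suc False by (simp add: w algebra_simps)
  qed (use assms(1) in \<open>simp add: algebra_simps\<close>)
qed simp

text \<open>Serves both \<open>prime_pi\<close> and \<open>Li\<close>. Beyond
  \<open>nat \<lfloor>x\<rfloor>\<close> the argument of \<open>F\<close> is below 1, which makes
  the sum finite and kills the boundary term of \<open>sum_by_parts\<close>.\<close>

lemma infsum_weighted_differences:
  fixes w a :: "nat \<Rightarrow> real"
  assumes "a 1 = w 1" "\<And>j. j \<ge> 2 \<Longrightarrow> a j = w j - w (j - 1)"
    and F: "\<And>y. y < 2 \<Longrightarrow> F y = 0" and x: "x \<ge> 0"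
  shows "(\<Sum>\<^sub>\<infinity>k\<in>{1..}. w k * (F (x / real k) - F (x / real (k + 1)))) = dilation_sum a F x"
proof -
  let ?N = "nat \<lfloor>x\<rfloor>"
  have F0: "F (x / real k) = 0" if "?N < k" for k
    using divide_lt_1_of_nat_floor_less[OF that x] by (intro F) linarith
  have "(\<Sum>\<^sub>\<infinity>k\<in>{1..}. w k * (F (x / real k) - F (x / real (k + 1)))) =
      (\<Sum>\<^sub>\<infinity>k\<in>{1..?N}. w k * (F (x / real k) - F (x / real (k + 1))))"
    by (rule infsum_cong_neutral) (use F0 in \<open>auto simp del: of_nat_add of_nat_Suc\<close>)
  also have "\<dots> = (\<Sum>k = 1..?N. w k * (F (x / real k) - F (x / real (k + 1))))"
    by (rule infsum_finite) simp
  also have "\<dots> = dilation_sum a F x"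
    using sum_by_parts[of a w "\<lambda>k. F (x / real k)" ?N] assms(1,2) F0[of "?N + 1"]
    by (simp add: dilation_sum_def del: of_nat_add of_nat_Suc of_nat_nat)
  finally show ?thesis .
qed

text \<open>Lets \<open>bigo_dilation_sum\<close> be applied to a dilation sum in turn; the reason
  is \<open>x/k \<le> x\<close>.\<close>

lemma dilation_sum_eq_0:
  assumes "\<And>y. y < 2 \<Longrightarrow> F y = 0" "x < 2"
  shows "dilation_sum c F x = 0"
proof -
  have "F (x / real k) = 0" if "k \<in> {1..nat \<lfloor>x\<rfloor>}" for k
  proof -
    have "x \<ge> 0" "k \<ge> 1" using that by (auto, linarith)
    then have "x / real k \<le> x / 1" by (intro divide_left_mono) auto
    then show ?thesis using assms by simp
  qed
  then show ?thesis by (simp add: dilation_sum_def)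
qed

text \<open>Both sides run over the pairs with product at most \<open>N\<close>, grouped once by
  \<open>k\<close> and once by \<open>n = k * j\<close>, with \<open>r = j\<close>. This is used to
  compose dilation sums and to bound the norm of the inverse.\<close>

lemma sum_hyperbola_eq_sum_divisors:
  fixes h :: "nat \<Rightarrow> nat \<Rightarrow> real"
  shows "(\<Sum>k = 1..N. \<Sum>j = 1..N div k. h k j) = (\<Sum>n = 1..N. \<Sum>r | r dvd n. h (n div r) r)"
proof -
  have "(\<Sum>k = 1..N. \<Sum>j = 1..N div k. h k j) = (\<Sum>(k,j)\<in>(SIGMA k:{1..N}. {1..N div k}). h k j)"
    by (rule sum.Sigma) auto
  also have "\<dots> = (\<Sum>(n,r)\<in>(SIGMA n:{1..N}. {r. r dvd n}). h (n div r) r)"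
  proof (rule sum.reindex_bij_witness[where i = "\<lambda>(n,r). (n div r, r)" and j = "\<lambda>(k,j). (k * j, j)"])
    fix z assume "z \<in> (SIGMA n:{1..N}. {r. r dvd n})"
    then obtain m r where z: "z = (m * r, r)" "m * r \<ge> 1" "m * r \<le> N"
      by (cases z) (auto elim!: dvdE simp: mult.commute)
    then have pos: "m \<ge> 1" "r \<ge> 1" by (auto simp: Suc_le_eq)
    then have "r \<le> N div m"
      using z(3) by (simp add: less_eq_div_iff_mult_less_eq mult.commute)
    moreover have "m \<le> N"
      using z(3) pos mult_le_mono2[of 1 r m] by linarith
    ultimately
    show "(case z of (n, r) \<Rightarrow> (n div r, r)) \<in> (SIGMA k:{1..N}. {1..N div k})"
      using z pos by auto
  next
    fix z assume "z \<in> (SIGMA k:{1..N}. {1..N div k})"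
    then obtain k j where z: "z = (k, j)" "1 \<le> k" "1 \<le> j" "j \<le> N div k" by auto
    then have "k * j \<le> N" by (simp add: less_eq_div_iff_mult_less_eq mult.commute)
    then show "(case z of (k, j) \<Rightarrow> (k * j, j)) \<in> (SIGMA n:{1..N}. {r. r dvd n})"
      using z by auto
  qed auto
  also have "\<dots> = (\<Sum>n = 1..N. \<Sum>r | r dvd n. h (n div r) r)"
    by (rule sum.Sigma[symmetric]) auto
  finally show ?thesis .
qed

text \<open>Grouping the double sum by the product of the two indices leaves the coefficients
  \<open>dirichlet_conv a b\<close>, of which only the one at \<open>n = 1\<close> survives.\<close>

lemma dilation_sum_dirichlet_inverse:
  assumes inv: "is_dirichlet_inverse a b" and x: "x \<ge> 1"
  shows "dilation_sum b (dilation_sum a F) x = F x"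
proof -
  let ?N = "nat \<lfloor>x\<rfloor>"
  have "dilation_sum b (dilation_sum a F) x =
      (\<Sum>k = 1..?N. \<Sum>j = 1..?N div k. b k * (a j * F (x / real (k * j))))"
  proof -
    \<comment> \<open>Nested floors agree, so the inner cutoff selects exactly the pairs with
      \<open>k * j \<le> ?N\<close>.\<close>
    have "nat \<lfloor>x / real k\<rfloor> = ?N div k" for k
      using x floor_divide_real_eq_div[of "int k" x] by (simp add: nat_div_distrib)
    then show ?thesis by (simp add: dilation_sum_def sum_distrib_left)
  qed
  also have "\<dots> = (\<Sum>n = 1..?N. \<Sum>r | r dvd n. b (n div r) * (a r * F (x / real (n div r * r))))"
    by (rule sum_hyperbola_eq_sum_divisors)
  also have "\<dots> = (\<Sum>n = 1..?N. dirichlet_conv a b n * F (x / real n))"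
    by (auto simp: dirichlet_conv_def sum_distrib_right intro!: sum.cong)
  also have "\<dots> = (\<Sum>n = 1..?N. if n = 1 then F x else 0)"
    using inv by (intro sum.cong) (auto simp: is_dirichlet_inverse_def)
  also have "\<dots> = F x" using x by (simp add: le_nat_iff)
  finally show ?thesis .
qed

text \<open>Replacing \<open>x\<close> by \<open>x/k\<close> gains the factor
  \<open>k powr (-\<theta>)\<close> from the power, and the logarithmic factor does not increase.
  The constant thus grows at most by the weighted norm of \<open>c\<close>.\<close>

lemma bigo_dilation_sum:
  assumes c: "c \<in> ell1 \<theta>" and m: "m \<ge> 0" and F0: "\<And>y. y < 2 \<Longrightarrow> F y = 0"
    and F: "F \<in> O[principal {2..}](\<lambda>x. x powr \<theta> * ln (exp 1 * x) powr m)"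
  shows "dilation_sum c F \<in> O[principal {2..}](\<lambda>x. x powr \<theta> * ln (exp 1 * x) powr m)"
proof -
  define g where "g = (\<lambda>x::real. x powr \<theta> * ln (exp 1 * x) powr m)"
  define f where "f = (\<lambda>j. \<bar>c j\<bar> * real j powr (-\<theta>))"
  have g0: "g x \<ge> 0" for x by (simp add: g_def)
  from F obtain C where C: "C > 0" "\<And>x. x \<ge> 2 \<Longrightarrow> \<bar>F x\<bar> \<le> C * g x"
    using g0 by (auto elim!: landau_o.bigE simp: eventually_principal g_def)
  have sf: "f summable_on {1..}" using c by (simp add: ell1_def f_def)
  have "\<bar>dilation_sum c F x\<bar> \<le> C * infsum f {1..} * g x" if x: "x \<ge> 2" for x
  proof -
    have term_le: "\<bar>c k * F (x / real k)\<bar> \<le> f k * (C * g x)" if k: "k \<ge> 1" for k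
    proof (cases "x / real k < 2")
      \<comment> \<open>The bound with \<open>C\<close> is available only from 2 on; below 2 the
        vanishing of \<open>F\<close> replaces it.\<close>
      case True
      then show ?thesis using F0 g0 C(1) by (simp add: f_def)
    next
      case False
      have le: "x / real k \<le> x" using k x by (simp add: divide_le_eq)
      have pos: "x / real k > 0" using False by linarith
      \<comment> \<open>An argument of at least 1 makes the logarithm nonnegative, as monotonicity
        of \<open>powr m\<close> requires.\<close>
      have "1 * 1 \<le> exp 1 * (x / real k)" using False by (intro mult_mono) auto
      then have "ln (exp 1 * (x / real k)) powr m \<le> ln (exp 1 * x) powr m"
        using m le pos by (intro powr_mono2 ln_ge_zero) (auto simp del: times_divide_eq_right)
      then have "g (x / real k) \<le> (x / real k) powr \<theta> * ln (exp 1 * x) powr m"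
        unfolding g_def by (intro mult_left_mono) auto
      also have "\<dots> = real k powr (-\<theta>) * g x"
        using x k by (simp add: g_def powr_divide powr_minus field_simps)
      finally have "C * g (x / real k) \<le> C * (real k powr (-\<theta>) * g x)" using C(1) by simp
      then have "\<bar>F (x / real k)\<bar> \<le> C * (real k powr (-\<theta>) * g x)"
        using C(2)[of "x / real k"] False by linarith
      from mult_left_mono[OF this, of "\<bar>c k\<bar>"] show ?thesis
        by (simp add: f_def abs_mult mult_ac)
    qed
    have "\<bar>dilation_sum c F x\<bar> \<le> (\<Sum>k = 1..nat \<lfloor>x\<rfloor>. f k * (C * g x))"
      unfolding dilation_sum_def by (rule order_trans[OF sum_abs]) (intro sum_mono term_le, simp)
    also have "\<dots> = (\<Sum>k = 1..nat \<lfloor>x\<rfloor>. f k) * (C * g x)" by (simp add: sum_distrib_right)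
    also have "\<dots> \<le> infsum f {1..} * (C * g x)"
      using C(1) g0 by (intro mult_right_mono finite_sum_le_infsum[OF sf]) (auto simp: f_def)
    finally show ?thesis by (simp add: mult_ac)
  qed
  then show ?thesis
    using g0 unfolding g_def[symmetric]
    by (intro bigoI[where c = "C * infsum f {1..}"]) (simp add: eventually_principal)
qed

section \<open>Existence and summability of the Dirichlet inverse\<close>

fun dirichlet_inv :: "(nat \<Rightarrow> real) \<Rightarrow> nat \<Rightarrow> real" where
  "dirichlet_inv a n = (if n = 0 then 0 else if n = 1 then 1 / a 1 else
     - (\<Sum>r | r dvd n \<and> r > 1. a r * dirichlet_inv a (n div r)) / a 1)"

text \<open>The equation matches every argument and could unfold without end as a simp rule. The
  recursion terminates because \<open>r > 1\<close> gives \<open>n div r < n\<close> once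
  \<open>n = 0\<close> is excluded.\<close>

declare dirichlet_inv.simps [simp del]

text \<open>Isolating the divisor 1 allows the convolution identity to be solved for
  \<open>b n\<close>, both in the construction of an inverse and in its estimate.\<close>

lemma dirichlet_conv_split_1:
  assumes "n \<ge> 1"
  shows "dirichlet_conv a b n = a 1 * b n + (\<Sum>r | r dvd n \<and> r > 1. a r * b (n div r))"
proof -
  have "{r. r dvd n} = insert 1 {r. r dvd n \<and> r > 1}" using assms by (auto intro: Suc_lessI dvd_pos_nat)
  moreover have "finite {r. r dvd n \<and> r > 1}" using assms by simp
  ultimately show ?thesis by (simp add: dirichlet_conv_def)
qed

lemma is_dirichlet_inverse_dirichlet_inv:
  assumes "a 1 \<noteq> 0"
  shows "is_dirichlet_inverse a (dirichlet_inv a)"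
  unfolding is_dirichlet_inverse_def
proof (intro allI impI)
  fix n :: nat assume n: "n \<ge> 1"
  show "dirichlet_conv a (dirichlet_inv a) n = (if n = 1 then 1 else 0)"
  proof (cases "n = 1")
    case True
    then have "{r. r dvd n \<and> r > 1} = {}" by auto
    then show ?thesis using True assms n by (simp only: dirichlet_conv_split_1) (simp add: dirichlet_inv.simps)
  next
    case False
    then show ?thesis
      using assms n dirichlet_inv.simps[of a n] by (simp add: dirichlet_conv_split_1)
  qed
qed

text \<open>The absorption takes place in partial sums, which are finite, and gives the bound
  \<open>1 / (\<bar>a 1\<bar> - S)\<close> uniformly in \<open>N\<close>.\<close>

lemma dirichlet_inverse_in_ell1:
  assumes a1: "a 1 \<noteq> 0" and a: "a \<in> ell1 \<theta>" and inv: "is_dirichlet_inverse a b"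
    and small: "1 / \<bar>a 1\<bar> * (\<Sum>\<^sub>\<infinity>j\<in>{2..}. \<bar>a j\<bar> / real j powr \<theta>) < 1"
  shows "b \<in> ell1 \<theta>"
proof -
  define S where "S = (\<Sum>\<^sub>\<infinity>j\<in>{2..}. \<bar>a j\<bar> / real j powr \<theta>)"
  \<comment> \<open>With \<open>A 1 = 0\<close> the sums may run over all divisors, as
    \<open>sum_hyperbola_eq_sum_divisors\<close> requires, without bringing the divisor 1
    back.\<close>
  define A where "A = (\<lambda>j. if j > 1 then \<bar>a j\<bar> * real j powr (-\<theta>) else 0)"
  define B where "B = (\<lambda>j. \<bar>b j\<bar> * real j powr (-\<theta>))"
  have A0: "A j \<ge> 0" and B0: "B j \<ge> 0" for j by (auto simp: A_def B_def)
  have S: "S < \<bar>a 1\<bar>" using small a1 by (simp add: S_def divide_simps)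
  have S_eq: "S = infsum A {2..}"
    unfolding S_def by (rule infsum_cong) (auto simp: A_def powr_minus divide_inverse)
  have "(\<lambda>j. \<bar>a j\<bar> * real j powr (-\<theta>)) summable_on {2..}"
    using a by (auto simp: ell1_def intro: summable_on_subset_banach)
  then have sA: "A summable_on {2..}"
    by (rule summable_on_cong[THEN iffD1, rotated]) (auto simp: A_def)
  have A_le: "(\<Sum>j = 1..M. A j) \<le> S" for M
  proof -
    have "(\<Sum>j = 1..M. A j) = (\<Sum>j = 2..M. A j)"
      by (rule sum.mono_neutral_right) (auto simp: A_def)
    also have "\<dots> \<le> S" unfolding S_eq by (rule finite_sum_le_infsum[OF sA]) (auto simp: A0)
    finally show ?thesis .
  qed
  have step: "\<bar>a 1\<bar> * B n \<le> (if n = 1 then 1 else 0) + (\<Sum>r | r dvd n. B (n div r) * A r)"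
    if n: "n \<ge> 1" for n
  proof -
    let ?D = "{r. r dvd n \<and> r > 1}"
    have "a 1 * b n = (if n = 1 then 1 else 0) - (\<Sum>r\<in>?D. a r * b (n div r))"
      using inv n dirichlet_conv_split_1[OF n, of a b] by (simp add: is_dirichlet_inverse_def)
    then have "\<bar>a 1\<bar> * \<bar>b n\<bar> \<le> (if n = 1 then 1 else 0) + \<bar>\<Sum>r\<in>?D. a r * b (n div r)\<bar>"
      unfolding abs_mult[symmetric] by (simp del: One_nat_def split: if_splits)
    also have "\<dots> \<le> (if n = 1 then 1 else 0) + (\<Sum>r\<in>?D. \<bar>a r * b (n div r)\<bar>)"
      by (intro add_left_mono sum_abs)
    finally have "\<bar>a 1\<bar> * \<bar>b n\<bar> * real n powr (-\<theta>) \<le>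
        ((if n = 1 then 1 else 0) + (\<Sum>r\<in>?D. \<bar>a r * b (n div r)\<bar>)) * real n powr (-\<theta>)"
      by (rule mult_right_mono) simp
    also have "\<dots> = (if n = 1 then 1 else 0) + (\<Sum>r\<in>?D. \<bar>a r * b (n div r)\<bar> * real n powr (-\<theta>))"
      by (simp add: algebra_simps sum_distrib_left)
    also have "(\<Sum>r\<in>?D. \<bar>a r * b (n div r)\<bar> * real n powr (-\<theta>)) = (\<Sum>r\<in>?D. B (n div r) * A r)"
    proof (rule sum.cong[OF refl])
      fix r assume r: "r \<in> ?D"
      \<comment> \<open>The weight is multiplicative, so it splits along
        \<open>n = (n div r) * r\<close>.\<close>
      then have "real n = real (n div r) * real r" by (simp flip: of_nat_mult)
      then have "real n powr (-\<theta>) = real (n div r) powr (-\<theta>) * real r powr (-\<theta>)"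
        by (simp add: powr_mult)
      then show "\<bar>a r * b (n div r)\<bar> * real n powr (-\<theta>) = B (n div r) * A r"
        using r by (simp add: A_def B_def abs_mult)
    qed
    also have "(\<Sum>r\<in>?D. B (n div r) * A r) \<le> (\<Sum>r | r dvd n. B (n div r) * A r)"
      using n by (intro sum_mono2) (auto simp: A0 B0)
    finally show ?thesis by (simp add: B_def mult_ac)
  qed
  have bound: "(\<Sum>n = 1..N. B n) \<le> 1 / (\<bar>a 1\<bar> - S)" for N
  proof -
    have "\<bar>a 1\<bar> * (\<Sum>n = 1..N. B n) \<le>
        (\<Sum>n = 1..N. (if n = 1 then 1 else 0) + (\<Sum>r | r dvd n. B (n div r) * A r))"
      unfolding sum_distrib_left by (intro sum_mono step) simp
    also have "\<dots> = (\<Sum>n = 1..N. if n = 1 then 1 else 0) + (\<Sum>k = 1..N. \<Sum>j = 1..N div k. B k * A j)"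
      by (simp only: sum.distrib sum_hyperbola_eq_sum_divisors)
    also have "\<dots> \<le> 1 + (\<Sum>k = 1..N. B k * S)"
    proof (rule add_mono)
      \<comment> \<open>For fixed \<open>k\<close> the inner sum is a partial sum of
        \<open>A\<close>, hence at most \<open>S\<close> whatever its cutoff.\<close>
      show "(\<Sum>k = 1..N. \<Sum>j = 1..N div k. B k * A j) \<le> (\<Sum>k = 1..N. B k * S)"
        unfolding sum_distrib_left[symmetric] by (intro sum_mono mult_left_mono A_le B0)
    qed simp
    finally have "(\<Sum>n = 1..N. B n) * (\<bar>a 1\<bar> - S) \<le> 1"
      by (simp add: algebra_simps flip: sum_distrib_left)
    then show ?thesis using S by (simp add: pos_le_divide_eq)
  qed
  have "B summable_on {1..}"
  proof (rule nonneg_bdd_above_summable_on)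
    show "bdd_above (sum B ` {F. F \<subseteq> {1..} \<and> finite F})"
    proof (rule bdd_aboveI2)
      fix F assume "F \<in> {F. F \<subseteq> {1::nat..} \<and> finite F}"
      then have F: "F \<subseteq> {1..}" "finite F" by auto
      \<comment> \<open>Inserting 0 keeps \<open>Max\<close> meaningful for empty
        \<open>F\<close>.\<close>
      then have "F \<subseteq> {1..Max (insert 0 F)}" by auto
      then have "sum B F \<le> sum B {1..Max (insert 0 F)}" by (intro sum_mono2) (auto simp: B0)
      then show "sum B F \<le> 1 / (\<bar>a 1\<bar> - S)" using bound order_trans by blast
    qed
  qed (auto simp: B0)
  then show ?thesis by (simp add: ell1_def B_def)
qed

section \<open>Equivalence of the two error bounds\<close>

theorem theorem21:
  fixes \<theta> :: real and w a :: "nat \<Rightarrow> real"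
  assumes "\<theta> > 0"
    and "a 1 = w 1"
    and "\<And>j. j \<ge> 2 \<Longrightarrow> a j = w j - w (j - 1)"
    and "a 1 \<noteq> 0"
    and "a \<in> ell1 \<theta>"
  shows "(\<forall>b. is_dirichlet_inverse a b \<and> b \<in> ell1 \<theta> \<longrightarrow>
           (\<forall>m::real. m \<ge> 0 \<longrightarrow>
              ((\<lambda>x. prime_pi x - Li x)
                 \<in> O[principal {2..}](\<lambda>x. x powr \<theta> * ln (exp 1 * x) powr m)) \<longleftrightarrow>
              ((\<lambda>x. T_sum w x - M_sum w x)
                 \<in> O[principal {2..}](\<lambda>x. x powr \<theta> * ln (exp 1 * x) powr m))))
       \<and> (1 / \<bar>a 1\<bar> * (\<Sum>\<^sub>\<infinity>j\<in>{2..}. \<bar>a j\<bar> / real j powr \<theta>) < 1 \<longrightarrow>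
           (\<exists>b. is_dirichlet_inverse a b) \<and>
           (\<forall>b. is_dirichlet_inverse a b \<longrightarrow> b \<in> ell1 \<theta>))"
proof -
  define E where "E = (\<lambda>x. prime_pi x - Li x)"
  define D where "D = dilation_sum a E"
  have Li0: "Li y = 0" if "y < 2" for y using that by (simp add: Li_def)
  have E0: "E y = 0" if "y < 2" for y using that by (simp add: E_def Li0 prime_pi_eq_0)
  have D0: "D y = 0" if "y < 2" for y unfolding D_def using E0 that by (rule dilation_sum_eq_0)
  have TM: "T_sum w x - M_sum w x = D x" if x: "x \<ge> 2" for x
  proof -
    have "T_sum w x = (\<Sum>\<^sub>\<infinity>k\<in>{1..}. w k * (prime_pi (x / real k) - prime_pi (x / real (k + 1))))"
      unfolding T_sum_def using x
      by (intro infsum_cong) (simp add: simplicial_class_count_eq_prime_pi)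
    also have "\<dots> = dilation_sum a prime_pi x"
      using x by (intro infsum_weighted_differences assms(2,3) prime_pi_eq_0) auto
    finally have T: "T_sum w x = dilation_sum a prime_pi x" .
    have M: "M_sum w x = dilation_sum a Li x"
      unfolding M_sum_def using x by (intro infsum_weighted_differences assms(2,3) Li0) auto
    show ?thesis
      unfolding T M D_def E_def by (simp add: dilation_sum_def algebra_simps sum_subtractf)
  qed
  \<comment> \<open>The filter sees only \<open>x \<ge> 2\<close>, where \<open>TM\<close>
    holds.\<close>
  have cong: "((\<lambda>x. T_sum w x - M_sum w x) \<in> O[principal {2..}](g)) \<longleftrightarrow> D \<in> O[principal {2..}](g)"
    for g :: "real \<Rightarrow> real"
    by (rule landau_o.big.in_cong) (simp add: eventually_principal TM)
  show ?thesis
  proof (intro conjI impI allI)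
    fix b and m :: real
    assume b: "is_dirichlet_inverse a b \<and> b \<in> ell1 \<theta>" and m: "m \<ge> 0"
    let ?g = "\<lambda>x. x powr \<theta> * ln (exp 1 * x) powr m"
    have "E \<in> O[principal {2..}](?g)" if "D \<in> O[principal {2..}](?g)"
    proof -
      \<comment> \<open>The coefficients \<open>b\<close> preserve the bound on \<open>D\<close> and
        turn \<open>D\<close> back into \<open>E\<close>.\<close>
      have "dilation_sum b D \<in> O[principal {2..}](?g)"
        using b m D0 that by (intro bigo_dilation_sum) auto
      moreover have "dilation_sum b D x = E x" if "x \<ge> 2" for x
        unfolding D_def using b that by (intro dilation_sum_dirichlet_inverse) auto
      ultimately show ?thesis
        by (subst landau_o.big.in_cong[where g = "dilation_sum b D"])
          (auto simp: eventually_principal)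
    qed
    moreover have "D \<in> O[principal {2..}](?g)" if "E \<in> O[principal {2..}](?g)"
      unfolding D_def using assms(5) m E0 that by (rule bigo_dilation_sum)
    ultimately show "(\<lambda>x. prime_pi x - Li x) \<in> O[principal {2..}](?g) \<longleftrightarrow>
        (\<lambda>x. T_sum w x - M_sum w x) \<in> O[principal {2..}](?g)"
      unfolding cong E_def[symmetric] by blast
  next
    \<comment> \<open>Existence keeps the following claim about every inverse from being
      vacuous.\<close>
    show "\<exists>b. is_dirichlet_inverse a b"
      using is_dirichlet_inverse_dirichlet_inv assms(4) by blast
  next
    fix b
    assume "1 / \<bar>a 1\<bar> * (\<Sum>\<^sub>\<infinity>j\<in>{2..}. \<bar>a j\<bar> / real j powr \<theta>) < 1" "is_dirichlet_inverse a b"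
    then show "b \<in> ell1 \<theta>" using dirichlet_inverse_in_ell1 assms(4,5) by blast
  qed
qed

end
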